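(* Let $m<n$ be nonnegative integers. Then $f_{m,n}(x)=0$.
   Context: Let $k\ge 2$ be an integer and let $s_k(i)$ be the sum of the base-$k$ digits of $i$. Let $K$ be a field, $V$ a finite-dimensional $K$-vector space, $P\colon V\to V$ a $K$-linear map, $q\in V$, and $\zeta_k\in K$ with $\zeta_k^k=1$, $\zeta_k\neq 1$ (not necessarily primitive). Let $\mathbf u=(\mathbf u(n))_{n\ge 0}$ be the sequence in $V$ with $\mathbf u(0)=0$ and $\mathbf u(ki+j)=P(\mathbf u(i))+jq$ for all $i\ge 0$, $j=0,1,\ldots,k-1$. Let $\mathrm{Sym}(V)$ be the symmetric algebra of $V$. Zeroth powers equal $1$. For $m,n\ge 0$ put $$f_{m,n}(x)=\sum_{i=0}^{k^n-1}\zeta_k^{s_k(i)}(x+\mathbf u(i))^m\in\mathrm{Sym}(V)[x].$$ *)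

theory Defs
  imports
    Complex_Main
    "HOL-Algebra.UnivPoly"
    "HOL-Algebra.QuotRing"
    "HOL-Decision_Procs.Algebra_Aux"
    "HOL-Library.Poly_Mapping"
begin

(* For k < 2 the value is junk; the guard is only there for termination. *)
fun digit_sum :: "nat \<Rightarrow> nat \<Rightarrow> nat" where
  "digit_sum k i = (if k < 2 \<or> i = 0 then 0 else i mod k + digit_sum k (i div k))"

declare digit_sum.simps [simp del]

text \<open>
  The symmetric algebra of a vector space over a field is presented as the commutative algebra
  generated by the vectors, subject to the relations that make the inclusion of the vectors linear.
  The type \<open>('v \<Rightarrow>\<^sub>0 nat) \<Rightarrow>\<^sub>0 'k\<close> is the polynomial ring over \<open>'k\<close> with one (formal) variable
  for each vector.  The vector space structure is given by a term (the scalar multiplication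
  \<open>scale\<close>), so the quotient is a ring record and not a type.
\<close>

type_synonym ('k, 'v) vec_poly = "('v \<Rightarrow>\<^sub>0 nat) \<Rightarrow>\<^sub>0 'k"

definition const_poly :: "'k::field \<Rightarrow> ('k, 'v::ab_group_add) vec_poly" where
  "const_poly c = Poly_Mapping.single 0 c"

definition var_poly :: "'v::ab_group_add \<Rightarrow> ('k::field, 'v) vec_poly" where
  "var_poly v = Poly_Mapping.single (Poly_Mapping.single v 1) 1"

definition linear_relations ::
    "('k::field \<Rightarrow> 'v::ab_group_add \<Rightarrow> 'v) \<Rightarrow> ('k, 'v) vec_poly set" where
  "linear_relations scale =
     {var_poly (v + w) - (var_poly v + var_poly w) | v w. True} \<union>
     {var_poly (scale c v) - const_poly c * var_poly v | c v. True}"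

definition sym_ideal ::
    "('k::field \<Rightarrow> 'v::ab_group_add \<Rightarrow> 'v) \<Rightarrow> ('k, 'v) vec_poly set" where
  "sym_ideal scale = genideal cring_class_ops (linear_relations scale)"

definition Sym ::
    "('k::field \<Rightarrow> 'v::ab_group_add \<Rightarrow> 'v) \<Rightarrow> ('k, 'v) vec_poly set ring" where
  "Sym scale = cring_class_ops Quot sym_ideal scale"

definition sym_const ::
    "('k::field \<Rightarrow> 'v::ab_group_add \<Rightarrow> 'v) \<Rightarrow> 'k \<Rightarrow> ('k, 'v) vec_poly set" where
  "sym_const scale c = sym_ideal scale +>\<^bsub>cring_class_ops\<^esub> const_poly c"

definition sym_vec ::
    "('k::field \<Rightarrow> 'v::ab_group_add \<Rightarrow> 'v) \<Rightarrow> 'v \<Rightarrow> ('k, 'v) vec_poly set" where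
  "sym_vec scale v = sym_ideal scale +>\<^bsub>cring_class_ops\<^esub> var_poly v"

definition f_poly ::
    "('k::field \<Rightarrow> 'v::ab_group_add \<Rightarrow> 'v) \<Rightarrow> nat \<Rightarrow> 'k \<Rightarrow> (nat \<Rightarrow> 'v) \<Rightarrow> nat \<Rightarrow> nat
      \<Rightarrow> nat \<Rightarrow> ('k, 'v) vec_poly set" where
  "f_poly scale k \<zeta> u m n =
     (let S = Sym scale; P = UP S; x = monom P \<one>\<^bsub>S\<^esub> 1 in
      \<Oplus>\<^bsub>P\<^esub>i\<in>{0..k ^ n - 1}.
        sym_const scale (\<zeta> ^ digit_sum k i)
          \<odot>\<^bsub>P\<^esub> (x \<oplus>\<^bsub>P\<^esub> monom P (sym_vec scale (u i)) 0) [^]\<^bsub>P\<^esub> m)"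

lemma ideal_sym_ideal: "ideal (sym_ideal scale) cring_class_ops"
  unfolding sym_ideal_def
  by (rule ring.genideal_ideal) (auto simp: carrier_class cring.axioms(1)[OF cring_class])

lemma cring_Sym: "cring (Sym scale)"
  unfolding Sym_def by (rule ideal.quotient_is_cring[OF ideal_sym_ideal cring_class])

lemma sym_coset_hom:
  "(+>\<^bsub>cring_class_ops\<^esub>) (sym_ideal scale) \<in> ring_hom cring_class_ops (Sym scale)"
  unfolding Sym_def by (rule ideal.rcos_ring_hom[OF ideal_sym_ideal])

lemma sym_coset_eqI:
  assumes "a - b \<in> linear_relations scale"
  shows "sym_ideal scale +>\<^bsub>cring_class_ops\<^esub> a = sym_ideal scale +>\<^bsub>cring_class_ops\<^esub> b"
proof -
  have "a - b \<in> sym_ideal scale"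
    unfolding sym_ideal_def
    using assms ring.genideal_self[OF cring.axioms(1)[OF cring_class]]
    by (metis carrier_class subsetD subsetI)
  then show ?thesis
    using ring.quotient_eq_iff_same_a_r_cos[OF cring.axioms(1)[OF cring_class] ideal_sym_ideal]
    by (metis carrier_class minus_class)
qed

lemma sym_vec_closed: "sym_vec scale v \<in> carrier (Sym scale)"
  unfolding sym_vec_def by (rule ring_hom_closed[OF sym_coset_hom carrier_class])

lemma sym_vec_add: "sym_vec scale (v + w) = sym_vec scale v \<oplus>\<^bsub>Sym scale\<^esub> sym_vec scale w"
proof -
  have "sym_vec scale (v + w) = sym_ideal scale +>\<^bsub>cring_class_ops\<^esub> (var_poly v + var_poly w)"
    unfolding sym_vec_def by (rule sym_coset_eqI) (auto simp: linear_relations_def)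
  then show ?thesis
    using ring_hom_add[OF sym_coset_hom carrier_class carrier_class]
    by (metis plus_class sym_vec_def)
qed

lemma sym_vec_scale:
  "sym_vec scale (scale c v) = sym_const scale c \<otimes>\<^bsub>Sym scale\<^esub> sym_vec scale v"
proof -
  have "sym_vec scale (scale c v) =
      sym_ideal scale +>\<^bsub>cring_class_ops\<^esub> (const_poly c * var_poly v)"
    unfolding sym_vec_def by (rule sym_coset_eqI) (auto simp: linear_relations_def)
  then show ?thesis
    using ring_hom_mult[OF sym_coset_hom carrier_class carrier_class]
    by (metis times_class sym_vec_def sym_const_def)
qed

lemma sym_const_hom: "sym_const scale \<in> ring_hom cring_class_ops (Sym scale)"
proof -
  have "const_poly \<in> ring_hom cring_class_ops cring_class_ops"
    by (rule ring_hom_memI)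
      (auto simp: const_poly_def carrier_class class_simps mult_single single_add)
  moreover have "sym_const scale = (+>\<^bsub>cring_class_ops\<^esub>) (sym_ideal scale) \<circ> const_poly"
    by (auto simp: sym_const_def)
  ultimately show ?thesis
    using ring_hom_trans sym_coset_hom by metis
qed

end

theory Submission
  imports Defs
begin

text \<open>
  The sum is a discrete analogue of an \<open>n\<close>-fold difference operator acting on a polynomial of
  degree \<open>m < n\<close>.  Splitting off the leading base-\<open>k\<close> digit \<open>j\<close> of an index below \<open>k ^ (n + 1)\<close>
  multiplies the weight by \<open>\<zeta> ^ j\<close> and translates \<open>u\<close> by \<open>j\<close> times the fixed vector \<open>P\<^sup>n q\<close>
  (\<open>digit_sum_top_digit\<close>, \<open>top_digit_shift\<close>).  So the indices below \<open>k ^ (n + 1)\<close> form \<open>k\<close>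
  translated copies of the indices below \<open>k ^ n\<close>, the \<open>j\<close>-th one carrying the extra weight
  \<open>\<zeta> ^ j\<close>.

  By induction on \<open>n\<close>, all moments of order less than \<open>n\<close> of the points \<open>x + u i\<close> with
  \<open>i < k ^ n\<close>, weighted by \<open>\<zeta>\<close> to the digit sum of \<open>i\<close>, vanish
  (\<open>digit_weighted_moment_eq_0\<close>).  If the moments of order less than \<open>n\<close> of a weighted
  family vanish, then its moments of order at most \<open>n\<close> do not change under a translation
  (\<open>moment_translate\<close>).  Hence for \<open>m \<le> n\<close> the \<open>k\<close> copies contribute together
  \<open>1 + \<zeta> + \<dots> + \<zeta> ^ (k - 1)\<close> times one moment of order \<open>m\<close>, and this factor is
  \<open>0\<close> because \<open>\<zeta> ^ k = 1\<close> and \<open>\<zeta> \<noteq> 1\<close>.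

  Removing the last digit would apply \<open>P\<close> to all points and force an extension of \<open>P\<close> to the
  symmetric algebra.  Removing the leading digit only translates the points, so the argument runs in
  any commutative ring that receives the scalars by a ring homomorphism and the vectors by an
  additive map; here it is the ring of polynomials over the symmetric algebra, with scalars and
  vectors embedded as constant polynomials.
\<close>

lemma digit_sum_append:
  assumes "k \<ge> 2" "b < k"
  shows "digit_sum k (k * a + b) = b + digit_sum k a"
proof (cases "k * a + b = 0")
  case True
  then show ?thesis using assms by (simp add: digit_sum.simps)
next
  case False
  then show ?thesis using assms by (subst digit_sum.simps) auto
qed

text \<open>
  The recursions for the digit sum and for \<open>u\<close> act on the last digit.  This identity makes them
  usable for the leading digit \<open>j\<close>: removing the last digit \<open>i mod k\<close> leaves \<open>j\<close> in front
  of one digit fewer, so facts on the leading digit follow by induction on \<open>n\<close>.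
\<close>

lemma top_digit_induct_step:
  fixes i j k n :: nat
  shows "j * k ^ Suc n + i = k * (j * k ^ n + i div k) + i mod k"
  by (simp add: algebra_simps)

lemma digit_sum_top_digit:
  assumes "k \<ge> 2" "j < k" "i < k ^ n"
  shows "digit_sum k (j * k ^ n + i) = j + digit_sum k i"
  using assms(3)
proof (induction n arbitrary: i)
  case 0
  then show ?case
    using digit_sum_append[OF assms(1,2), of 0] by (simp add: digit_sum.simps)
next
  case (Suc n)
  have r: "i mod k < k" using assms by simp
  have "i div k < k ^ n"
    using Suc.prems by (simp add: less_mult_imp_div_less mult.commute)
  then have "digit_sum k (j * k ^ Suc n + i) = i mod k + (j + digit_sum k (i div k))"
    unfolding top_digit_induct_step
    using Suc.IH by (simp only: digit_sum_append[OF assms(1) r])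
  also have "\<dots> = j + digit_sum k (k * (i div k) + i mod k)"
    by (simp only: digit_sum_append[OF assms(1) r])
  finally show ?case by simp
qed

lemma top_digit_shift:
  fixes scale :: "'k::field \<Rightarrow> 'v::ab_group_add \<Rightarrow> 'v"
  assumes lin: "Vector_Spaces.linear scale scale P"
    and u0: "u 0 = 0"
    and rec: "\<And>i j. j < k \<Longrightarrow> u (k * i + j) = P (u i) + scale (of_nat j) q"
    and j: "j < k" and i: "i < k ^ n"
  shows "u (j * k ^ n + i) = u i + scale (of_nat j) ((P ^^ n) q)"
  using i
proof (induction n arbitrary: i)
  case 0
  then show ?case
    using rec[OF j, of 0] u0
    by (simp add: module_hom.zero[OF Vector_Spaces.linear.axioms(3)[OF lin]])
next
  case (Suc n)
  note hom = Vector_Spaces.linear.axioms(3)[OF lin]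
  have r: "i mod k < k" using j by simp
  have "i div k < k ^ n"
    using Suc.prems by (simp add: less_mult_imp_div_less mult.commute)
  then have "u (j * k ^ Suc n + i) =
      P (u (i div k) + scale (of_nat j) ((P ^^ n) q)) + scale (of_nat (i mod k)) q"
    unfolding top_digit_induct_step
    using Suc.IH by (simp only: rec[OF r])
  also have "\<dots> = u (k * (i div k) + i mod k) + scale (of_nat j) (P ((P ^^ n) q))"
    unfolding rec[OF r] module_hom.add[OF hom] module_hom.scale[OF hom] by (simp add: add_ac)
  finally show ?case by simp
qed

text \<open>
  The binomial expansion of \<open>(w + y)\<^sup>a\<close> has leading term \<open>w\<^sup>a\<close>, and its other terms are
  multiples of lower powers of \<open>w\<close>, whose moments vanish.  The factor \<open>w\<^sup>b\<close> makes an induction on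
  \<open>a\<close> possible in place of the expansion: one factor \<open>w + y\<close> splits into a \<open>w\<close>, which
  joins \<open>w\<^sup>b\<close>, and a \<open>y\<close>, which leaves a vanishing moment.
\<close>

lemma (in cring) moment_translate_mixed:
  fixes a b n :: nat
  assumes c: "c \<in> A \<rightarrow> carrier R" and w: "w \<in> A \<rightarrow> carrier R" and y: "y \<in> carrier R"
    and vanish: "\<And>r. r < n \<Longrightarrow> (\<Oplus>i\<in>A. c i \<otimes> w i [^] r) = \<zero>"
    and "a + b \<le> n"
  shows "(\<Oplus>i\<in>A. c i \<otimes> ((w i \<oplus> y) [^] a \<otimes> w i [^] b)) = (\<Oplus>i\<in>A. c i \<otimes> w i [^] (a + b))"
  using \<open>a + b \<le> n\<close>
proof (induction a arbitrary: b)
  case 0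
  show ?case
    by (rule finsum_cong') (use c w in \<open>auto simp: Pi_iff\<close>)
next
  case (Suc a)
  let ?g = "\<lambda>b i. c i \<otimes> ((w i \<oplus> y) [^] a \<otimes> w i [^] b)"
  have closed: "?g b \<in> A \<rightarrow> carrier R" for b :: nat
    using c w y by (auto simp: Pi_iff)
  have "(\<Oplus>i\<in>A. c i \<otimes> ((w i \<oplus> y) [^] Suc a \<otimes> w i [^] b))
      = (\<Oplus>i\<in>A. ?g (Suc b) i \<oplus> y \<otimes> ?g b i)"
  proof (rule finsum_cong')
    fix i assume "i \<in> A"
    then have "c i \<in> carrier R" "w i \<in> carrier R" using c w by auto
    then show "c i \<otimes> ((w i \<oplus> y) [^] Suc a \<otimes> w i [^] b) = ?g (Suc b) i \<oplus> y \<otimes> ?g b i"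
      using y by (simp add: l_distr r_distr m_ac)
  qed (use c w y in \<open>auto simp: Pi_iff\<close>)
  also have "\<dots> = (\<Oplus>i\<in>A. ?g (Suc b) i) \<oplus> (\<Oplus>i\<in>A. y \<otimes> ?g b i)"
    by (rule finsum_addf) (use c w y in \<open>auto simp: Pi_iff\<close>)
  also have "(\<Oplus>i\<in>A. y \<otimes> ?g b i) = y \<otimes> (\<Oplus>i\<in>A. ?g b i)"
  proof (cases "finite A")
    case True
    then show ?thesis using finsum_rdistr[OF _ y closed, of b] by simp
  qed (simp add: y)
  also have "(\<Oplus>i\<in>A. ?g b i) = \<zero>"
    using Suc.IH[of b] Suc.prems vanish[of "a + b"] by simp
  also have "(\<Oplus>i\<in>A. ?g (Suc b) i) = (\<Oplus>i\<in>A. c i \<otimes> w i [^] (Suc a + b))"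
    using Suc.IH[of "Suc b"] Suc.prems by simp
  finally show ?case
    using y c w by (simp add: finsum_closed Pi_iff)
qed

lemma (in cring) moment_translate:
  fixes m n :: nat
  assumes c: "c \<in> A \<rightarrow> carrier R" and w: "w \<in> A \<rightarrow> carrier R" and y: "y \<in> carrier R"
    and vanish: "\<And>r. r < n \<Longrightarrow> (\<Oplus>i\<in>A. c i \<otimes> w i [^] r) = \<zero>"
    and "m \<le> n"
  shows "(\<Oplus>i\<in>A. c i \<otimes> (w i \<oplus> y) [^] m) = (\<Oplus>i\<in>A. c i \<otimes> w i [^] m)"
proof -
  have "(\<Oplus>i\<in>A. c i \<otimes> (w i \<oplus> y) [^] m) = (\<Oplus>i\<in>A. c i \<otimes> ((w i \<oplus> y) [^] m \<otimes> w i [^] (0::nat)))"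
    by (rule finsum_cong') (use c w y in \<open>auto simp: Pi_iff\<close>)
  then show ?thesis
    using moment_translate_mixed[where n = n and a = m and b = 0, OF c w y vanish] \<open>m \<le> n\<close> by simp
qed

lemma (in abelian_monoid) finsum_add_lessThan:
  fixes a b :: nat
  assumes f: "f \<in> {..<a + b} \<rightarrow> carrier G"
  shows "(\<Oplus>i\<in>{..<a + b}. f i) = (\<Oplus>i\<in>{..<a}. f i) \<oplus> (\<Oplus>i\<in>{..<b}. f (a + i))"
proof -
  have split: "{..<a + b} = {..<a} \<union> (+) a ` {..<b}"
    by (simp add: lessThan_atLeast0 image_add_atLeastLessThan ivl_disj_un add.commute)
  have "(\<Oplus>i\<in>{..<a + b}. f i) = (\<Oplus>i\<in>{..<a}. f i) \<oplus> (\<Oplus>i\<in>(+) a ` {..<b}. f i)"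
    unfolding split by (rule finsum_Un_disjoint) (use f in \<open>auto simp: Pi_iff\<close>)
  also have "(\<Oplus>i\<in>(+) a ` {..<b}. f i) = (\<Oplus>i\<in>{..<b}. f (a + i))"
    by (rule finsum_reindex) (use f in \<open>auto simp: Pi_iff\<close>)
  finally show ?thesis .
qed

lemma sum_powers_root_of_unity_eq_0:
  fixes \<zeta> :: "'k::field"
  assumes "\<zeta> ^ k = 1" "\<zeta> \<noteq> 1"
  shows "(\<Sum>j<k. \<zeta> ^ j) = 0"
  using assms by (simp add: geometric_sum)

text \<open>
  The induction on the number of digits.  For \<open>m \<le> n\<close>, each of the \<open>k\<close> translated
  copies of the indices below \<open>k ^ n\<close> contributes a multiple of one and the same moment \<open>M\<close>,
  and \<open>M\<close> itself may be nonzero when \<open>m = n\<close>: only the sum of the multipliers \<open>\<zeta> ^ j\<close>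
  vanishes.  The maps \<open>h\<close> and \<open>e\<close> are the images of scalars and of vectors in the ring.
\<close>

lemma (in cring) digit_weighted_moment_eq_0:
  fixes scale :: "'k::field \<Rightarrow> 'v::ab_group_add \<Rightarrow> 'v" and \<zeta> :: 'k and k :: nat
  assumes k: "k \<ge> 2"
    and lin: "Vector_Spaces.linear scale scale P"
    and root: "\<zeta> ^ k = 1" "\<zeta> \<noteq> 1"
    and u0: "u 0 = 0"
    and rec: "\<And>i j. j < k \<Longrightarrow> u (k * i + j) = P (u i) + scale (of_nat j) q"
    and h_closed: "\<And>a. h a \<in> carrier R"
    and h_zero: "h 0 = \<zero>"
    and h_add: "\<And>a b. h (a + b) = h a \<oplus> h b"
    and h_mult: "\<And>a b. h (a * b) = h a \<otimes> h b"
    and e_closed: "\<And>v. e v \<in> carrier R"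
    and e_add: "\<And>v w. e (v + w) = e v \<oplus> e w"
    and x: "x \<in> carrier R"
    and "m < n"
  shows "(\<Oplus>i\<in>{..<k ^ n}. h (\<zeta> ^ digit_sum k i) \<otimes> (x \<oplus> e (u i)) [^] m) = \<zero>"
  using \<open>m < n\<close>
proof (induction n arbitrary: m)
  case 0
  then show ?case by simp
next
  case (Suc n)
  let ?N = "k ^ n"
  let ?c = "\<lambda>i. h (\<zeta> ^ digit_sum k i)" and ?w = "\<lambda>i. x \<oplus> e (u i)"
  let ?M = "\<Oplus>i\<in>{..<?N}. ?c i \<otimes> ?w i [^] m"
  have w: "?w i \<in> carrier R" for i using x e_closed by simp
  have summand: "?c i \<otimes> ?w i [^] r \<in> carrier R" for i and r :: nat
    using h_closed w by simp
  have M: "?M \<in> carrier R" by (rule finsum_closed) (use summand in simp)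
  have block: "(\<Oplus>i\<in>{..<?N}. ?c (j * ?N + i) \<otimes> ?w (j * ?N + i) [^] m) = h (\<zeta> ^ j) \<otimes> ?M"
    if j: "j < k" for j
  proof -
    let ?y = "e (scale (of_nat j) ((P ^^ n) q))"
    have "(\<Oplus>i\<in>{..<?N}. ?c (j * ?N + i) \<otimes> ?w (j * ?N + i) [^] m)
        = (\<Oplus>i\<in>{..<?N}. h (\<zeta> ^ j) \<otimes> (?c i \<otimes> (?w i \<oplus> ?y) [^] m))"
    proof (rule finsum_cong')
      fix i assume "i \<in> {..<?N}"
      then have i: "i < ?N" by simp
      have "?w (j * ?N + i) = ?w i \<oplus> ?y"
        by (simp add: top_digit_shift[OF lin u0 rec j i] e_add e_closed x a_assoc)
      then show "?c (j * ?N + i) \<otimes> ?w (j * ?N + i) [^] m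
          = h (\<zeta> ^ j) \<otimes> (?c i \<otimes> (?w i \<oplus> ?y) [^] m)"
        by (simp add: digit_sum_top_digit[OF k j i] power_add h_mult h_closed w e_closed m_assoc)
    qed (use h_closed w e_closed in auto)
    also have "\<dots> = h (\<zeta> ^ j) \<otimes> (\<Oplus>i\<in>{..<?N}. ?c i \<otimes> (?w i \<oplus> ?y) [^] m)"
      by (rule finsum_rdistr[symmetric]) (use h_closed w e_closed in auto)
    also have "(\<Oplus>i\<in>{..<?N}. ?c i \<otimes> (?w i \<oplus> ?y) [^] m) = ?M"
      by (rule moment_translate[where n = n])
        (use h_closed w e_closed Suc in auto)
    finally show ?thesis .
  qed
  have "(\<Oplus>i\<in>{..<j * ?N}. ?c i \<otimes> ?w i [^] m) = h (\<Sum>l<j. \<zeta> ^ l) \<otimes> ?M" if "j \<le> k" for j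
    using that
  proof (induction j)
    case 0
    show ?case using M h_zero by simp
  next
    case (Suc j)
    have "(\<Oplus>i\<in>{..<j * ?N + ?N}. ?c i \<otimes> ?w i [^] m) = h (\<Sum>l<j. \<zeta> ^ l) \<otimes> ?M \<oplus> h (\<zeta> ^ j) \<otimes> ?M"
      using finsum_add_lessThan[of "\<lambda>i. ?c i \<otimes> ?w i [^] m" "j * ?N" ?N] summand
        Suc block[of j] by simp
    then show ?case
      using M h_closed by (simp add: h_add l_distr add.commute a_comm)
  qed
  from this[of k] show ?case
    using sum_powers_root_of_unity_eq_0[OF root] M h_zero by simp
qed

theorem proposition2p4:
  fixes scale :: "'k::field \<Rightarrow> 'v::ab_group_add \<Rightarrow> 'v"
    and Basis :: "'v set"
    and P :: "'v \<Rightarrow> 'v"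
    and q :: 'v
    and \<zeta> :: 'k
    and u :: "nat \<Rightarrow> 'v"
    and k m n :: nat
  assumes "k \<ge> 2"
    and "finite_dimensional_vector_space scale Basis"
    and "Vector_Spaces.linear scale scale P"
    and "\<zeta> ^ k = 1" and "\<zeta> \<noteq> 1"
    and "u 0 = 0"
    and "\<And>i j. j < k \<Longrightarrow> u (k * i + j) = P (u i) + scale (of_nat j) q"
    and "m < n"
  shows "f_poly scale k \<zeta> u m n = \<zero>\<^bsub>UP (Sym scale)\<^esub>"
proof -
  let ?S = "Sym scale"
  let ?U = "UP ?S"
  interpret S: cring ?S by (rule cring_Sym)
  interpret U: UP_cring ?S ?U by unfold_locales simp
  let ?x = "monom ?U \<one>\<^bsub>?S\<^esub> 1"
  let ?h = "\<lambda>c. monom ?U (sym_const scale c) 0"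
  let ?e = "\<lambda>v. monom ?U (sym_vec scale v) 0"
  have const_closed: "sym_const scale c \<in> carrier ?S" for c
    by (rule ring_hom_closed[OF sym_const_hom carrier_class])
  have const_add: "sym_const scale (a + b) = sym_const scale a \<oplus>\<^bsub>?S\<^esub> sym_const scale b" for a b
    using ring_hom_add[OF sym_const_hom carrier_class carrier_class] by (metis plus_class)
  have const_mult: "sym_const scale (a * b) = sym_const scale a \<otimes>\<^bsub>?S\<^esub> sym_const scale b" for a b
    using ring_hom_mult[OF sym_const_hom carrier_class carrier_class] by (metis times_class)
  have const_zero: "sym_const scale 0 = \<zero>\<^bsub>?S\<^esub>"
    using const_add[of 0 0] const_closed[of 0] S.add.r_cancel_one' by (metis add_0)
  note closed = const_closed sym_vec_closed
  have index: "{0..k ^ n - 1} = {..<k ^ n}"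
    using \<open>k \<ge> 2\<close> by (auto simp: Suc_le_eq[symmetric] le_diff_conv2)
  have "f_poly scale k \<zeta> u m n =
      (\<Oplus>\<^bsub>?U\<^esub>i\<in>{..<k ^ n}. sym_const scale (\<zeta> ^ digit_sum k i)
        \<odot>\<^bsub>?U\<^esub> (?x \<oplus>\<^bsub>?U\<^esub> ?e (u i)) [^]\<^bsub>?U\<^esub> m)"
    by (simp only: f_poly_def Let_def index)
  also have "\<dots> = (\<Oplus>\<^bsub>?U\<^esub>i\<in>{..<k ^ n}. ?h (\<zeta> ^ digit_sum k i)
        \<otimes>\<^bsub>?U\<^esub> (?x \<oplus>\<^bsub>?U\<^esub> ?e (u i)) [^]\<^bsub>?U\<^esub> m)"
    by (rule U.P.finsum_cong')
      (auto simp: U.monom_mult_is_smult closed)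
  also have "\<dots> = \<zero>\<^bsub>?U\<^esub>"
  proof (rule U.P.digit_weighted_moment_eq_0[where h = ?h and e = ?e, OF assms(1,3-7)])
    show "?h (a * b) = ?h a \<otimes>\<^bsub>?U\<^esub> ?h b" for a b
      using U.monom_mult[of "sym_const scale a" "sym_const scale b" 0 0]
      by (simp add: const_mult closed)
  qed (simp_all add: closed const_zero const_add sym_vec_add \<open>m < n\<close>)
  finally show ?thesis .
qed

end
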